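(* Let $G$ be a commutative group with identity $0$, let $k,n\in\mathbb N$, let $A:G^n\to G^k$ be a group homomorphism, and let $b\in G^k$ with $b\neq 0$. Then the equation $Ax=b$ (with $x\in G^n$) is partition regular over $G$ if and only if it has a constant solution, i.e., there is $y\in G$ with $A(y,y,\dots,y)=b$.
   Context: The equation $Ax=b$ is partition regular over $G$ if for every finite coloring of $G$ (i.e., every partition of $G$ into finitely many classes) there exists $x=(x_1,\dots,x_n)\in G^n$ with $Ax=b$ such that $x_1,\dots,x_n$ all have the same color. *)

theory Defs
  imports "HOL-Algebra.Algebra" "HOL-Library.Disjoint_Sets"
begin

text \<open>
  Groups are written multiplicatively, as in HOL-Algebra: the identity \<open>0\<close> of the informal
  statement is \<open>\<one>\<close>. Tuples are extensional functions on \<open>{..<n}\<close>.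
\<close>

abbreviation power_group :: "('a, 'b) monoid_scheme \<Rightarrow> nat \<Rightarrow> (nat \<Rightarrow> 'a) monoid"
  where "power_group G n \<equiv> product_group {..<n} (\<lambda>_. G)"

definition partition_regular ::
    "('a, 'b) monoid_scheme \<Rightarrow> nat \<Rightarrow> ((nat \<Rightarrow> 'a) \<Rightarrow> (nat \<Rightarrow> 'a)) \<Rightarrow> (nat \<Rightarrow> 'a) \<Rightarrow> bool"
  where "partition_regular G n A b \<longleftrightarrow>
    (\<forall>P. partition_on (carrier G) P \<and> finite P \<longrightarrow>
      (\<exists>x \<in> carrier (power_group G n). A x = b \<and> (\<exists>C\<in>P. \<forall>i<n. x i \<in> C)))"

end

theory Submission
  imports Defs
begin

text \<open>
  If \<open>b\<close> is not in the image \<open>K\<close> of the constant tuples, then, the circle being divisible, some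
  character \<open>\<chi>\<close> of \<open>G\<^sup>k\<close> is trivial on \<open>K\<close> but not at \<open>b\<close>. Now \<open>\<chi> (A x)\<close> is a product of
  characters \<open>f\<^sub>i (x\<^sub>i)\<close> of \<open>G\<close> with \<open>\<Prod>\<^sub>i f\<^sub>i (y) = 1\<close> for every \<open>y\<close>. Colour \<open>g\<close> by the cells of a
  fine grid that contain \<open>f\<^sub>0 (g), \<dots>, f\<^sub>n\<^sub>-\<^sub>1 (g)\<close>. For a monochromatic \<open>x\<close> and \<open>y\<close> of the same
  colour, \<open>\<chi> (A x)\<close> is close to \<open>\<Prod>\<^sub>i f\<^sub>i (y) = 1\<close>, so it cannot be \<open>\<chi> b\<close>.
\<close>

subsection \<open>Characters separating a point from a subgroup\<close>

definition circle_group :: "complex monoid"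
  where "circle_group = \<lparr>carrier = {z. cmod z = 1}, monoid.mult = (*), one = 1\<rparr>"

lemma circle_group_simps [simp]:
  "carrier circle_group = {z. cmod z = 1}"
  "x \<otimes>\<^bsub>circle_group\<^esub> y = x * y"
  "\<one>\<^bsub>circle_group\<^esub> = 1"
  by (simp_all add: circle_group_def)

lemma comm_group_circle_group: "comm_group circle_group"
proof (rule comm_groupI)
  fix x assume "x \<in> carrier circle_group"
  then have "x \<noteq> 0" by auto
  with \<open>x \<in> _\<close> have "inverse x \<in> carrier circle_group" "inverse x * x = 1"
    by (auto simp: norm_inverse)
  then show "\<exists>y\<in>carrier circle_group. y \<otimes>\<^bsub>circle_group\<^esub> x = \<one>\<^bsub>circle_group\<^esub>"
    by auto
qed (auto simp: norm_mult)

lemma circle_group_pow [simp]: "z [^]\<^bsub>circle_group\<^esub> (n::nat) = z ^ n"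
  by (induction n) (simp_all add: nat_pow_def)

text \<open>A nonzero complex number has \<open>m\<close> distinct \<open>m\<close>-th roots, so
  with \<open>m \<ge> 2\<close> one of them differs from 1. This is the form in which divisibility
  of the circle is used.\<close>

lemma nontrivial_root_in_circle:
  assumes "cmod v = 1" "m \<ge> 2"
  obtains w where "cmod w = 1" "w ^ m = v" "w \<noteq> 1"
proof -
  have "card {z. z ^ m = v} = m"
    using assms by (intro card_nth_roots) auto
  then have "\<not> {z. z ^ m = v} \<subseteq> {1}"
    using assms(2) card_mono[of "{1::complex}" "{z. z ^ m = v}"] by auto
  then obtain w where w: "w ^ m = v" "w \<noteq> 1" by blast
  then have "cmod w ^ m = 1 ^ m" using assms(1) by (metis norm_power power_one)
  then have "cmod w = 1"
    using assms(2) power_eq_imp_eq_base[of "cmod w" m 1] by simp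
  with w that show ?thesis by blast
qed

lemma comm_group_DirProd:
  assumes "comm_group G" "comm_group H"
  shows "comm_group (G \<times>\<times> H)"
proof -
  interpret G: comm_group G by fact
  interpret H: comm_group H by fact
  show ?thesis
    by (rule group.group_comm_groupI[OF DirProd_group[OF G.is_group H.is_group]])
       (auto simp: G.m_comm H.m_comm)
qed

text \<open>Graphs of characters of subgroups of \<open>G\<close>.\<close>

definition char_graph :: "('a, 'b) monoid_scheme \<Rightarrow> ('a \<times> complex) set \<Rightarrow> bool"
  where "char_graph G R \<longleftrightarrow>
    subgroup R (G \<times>\<times> circle_group) \<and> (\<forall>z. (\<one>\<^bsub>G\<^esub>, z) \<in> R \<longrightarrow> z = 1)"

text \<open>Division with remainder: \<open>j mod int m\<close> lies in \<open>D\<close> again and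
  is smaller than \<open>m\<close>, so minimality forces it to be 0.\<close>

lemma dvd_if_least_positive:
  fixes D :: "int set" and m :: nat
  assumes diff: "\<And>i j. i \<in> D \<Longrightarrow> j \<in> D \<Longrightarrow> i - j \<in> D"
    and mult: "\<And>i q. i \<in> D \<Longrightarrow> i * q \<in> D"
    and m: "m > 0" "int m \<in> D" and least: "\<And>l. l > 0 \<Longrightarrow> int l \<in> D \<Longrightarrow> m \<le> l"
    and j: "j \<in> D"
  shows "int m dvd j"
proof (rule ccontr)
  assume "\<not> int m dvd j"
  then have "j mod int m \<noteq> 0" by (simp add: dvd_eq_mod_eq_0)
  moreover have "j mod int m \<ge> 0" using m(1) by (intro pos_mod_sign) simp
  ultimately have pos: "j mod int m > 0" by linarith
  have "j mod int m = j - int m * (j div int m)"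
    by (simp add: minus_mult_div_eq_mod)
  then have "int (nat (j mod int m)) \<in> D"
    using diff[OF j mult[OF m(2)]] pos by simp
  from least[OF _ this] pos have "int m \<le> j mod int m" by simp
  moreover have "j mod int m < int m" using m(1) by (intro pos_mod_bound) simp
  ultimately show False by linarith
qed

text \<open>One extension step. The value \<open>w\<close> at a new point \<open>x\<close> need only
  be a root of the value already prescribed at the first positive power of \<open>x\<close> in the
  domain; if there is no such power, \<open>w\<close> is free. The clause
  \<open>w \<noteq> 1\<close> later separates \<open>b\<close> from \<open>K\<close>.\<close>

lemma (in comm_group) char_graph_extend:
  assumes R: "char_graph G R" and x: "x \<in> carrier G" "x \<notin> fst ` R"
  obtains R' w where "char_graph G R'" "R \<subseteq> R'" "(x, w) \<in> R'" "w \<noteq> 1"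
proof -
  interpret C: comm_group circle_group by (rule comm_group_circle_group)
  interpret P: comm_group "G \<times>\<times> circle_group"
    by (intro comm_group_DirProd comm_group_axioms C.comm_group_axioms)
  let ?P = "G \<times>\<times> circle_group"
  have sub: "subgroup R ?P" and sv: "\<And>z. (\<one>, z) \<in> R \<Longrightarrow> z = 1"
    using R by (auto simp: char_graph_def)
  interpret R: subgroup R ?P by (rule sub)
  have fst_hom: "fst \<in> hom ?P G" and snd_hom: "snd \<in> hom ?P circle_group"
    by (auto simp: hom_def norm_mult)
  have fst_int_pow: "fst (p [^]\<^bsub>?P\<^esub> i) = fst p [^] i" if "p \<in> carrier ?P" for p and i :: int
    using hom_int_pow[OF fst_hom that P.is_group is_group] .
  have fst_sub: "subgroup (fst ` R) G"
    using group_hom.subgroup_img_is_subgroup[OF _ sub] fst_hom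
    by (metis P.is_group group_hom.intro group_hom_axioms.intro is_group)
  \<comment> \<open>The ideal of exponents at which the old character already fixes the value. Its
    positive generator, if any, is the order of \<open>x\<close> modulo the domain.\<close>
  define D where "D = {j::int. x [^] j \<in> fst ` R}"
  have D_diff: "i - j \<in> D" if "i \<in> D" "j \<in> D" for i j
    using that x(1) subgroup.m_closed[OF fst_sub] subgroup.m_inv_closed[OF fst_sub]
    unfolding D_def by (simp add: int_pow_diff)
  have D_mult: "i * q \<in> D" if "i \<in> D" for i q
    using that x(1) subgroup_int_pow_closed[OF fst_sub]
    unfolding D_def by (simp add: int_pow_pow[symmetric])
  have D1: "1 \<notin> D" using x by (simp add: D_def)
  \<comment> \<open>\<open>w_D\<close> is the compatibility condition: wherever a power of
    \<open>x\<close> is in the old domain, the same power of \<open>w\<close> is its old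
    value.\<close>
  obtain w where w: "cmod w = 1" "w \<noteq> 1"
    and w_D: "\<And>j. j \<in> D \<Longrightarrow> (x, w) [^]\<^bsub>?P\<^esub> j \<in> R"
  proof (cases "D \<subseteq> {0}")
    case True
    show thesis
    \<comment> \<open>No nonzero power of \<open>x\<close> lies in the domain, so any point of the
      circle other than 1 would do.\<close>
    proof (rule that[of "-1"])
      fix j assume "j \<in> D"
      with True have "j = 0" by blast
      then show "(x, -1) [^]\<^bsub>?P\<^esub> j \<in> R" using R.one_closed by simp
    qed simp_all
  next
    case False
    then obtain i where "i \<in> D" "i \<noteq> 0" by blast
    then have "\<exists>l::nat. l > 0 \<and> int l \<in> D"
      using D_mult[of i "sgn i"] by (intro exI[of _ "nat \<bar>i\<bar>"]) (simp add: abs_sgn[symmetric])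
    define m where "m = (LEAST l::nat. l > 0 \<and> int l \<in> D)"
    have m: "m > 0" "int m \<in> D"
      using LeastI_ex[OF \<open>\<exists>l. _ l\<close>] by (auto simp: m_def)
    have least: "m \<le> l" if "l > 0" "int l \<in> D" for l
      unfolding m_def using that by (intro Least_le) auto
    \<comment> \<open>Here \<open>x\<close> lying outside the domain is used; it yields
      \<open>m \<ge> 2\<close>, hence a root other than 1.\<close>
    have "m \<noteq> 1" using D1 m(2) by auto
    with m have "m \<ge> 2" by linarith
    obtain v where v: "(x [^] int m, v) \<in> R"
      using m(2) by (auto simp: D_def)
    have "cmod v = 1" using R.mem_carrier[OF v] by simp
    then obtain w where w: "cmod w = 1" "w ^ m = v" "w \<noteq> 1"
      using nontrivial_root_in_circle \<open>m \<ge> 2\<close> by blast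
    have p: "(x, w) \<in> carrier ?P" using x w by simp
    have "snd ((x, w) [^]\<^bsub>?P\<^esub> m) = v"
      using hom_nat_pow[OF snd_hom p P.is_group C.is_group] w by simp
    \<comment> \<open>Both coordinates of this power agree with those of the pair
      \<open>(x [^] int m, v)\<close> in \<open>R\<close>.\<close>
    then have pm: "(x, w) [^]\<^bsub>?P\<^esub> int m \<in> R"
      using v fst_int_pow[OF p, of "int m"] by (simp add: int_pow_int prod_eq_iff) (metis prod.collapse)
    show thesis
    proof (rule that[OF w(1,3)])
      fix j assume "j \<in> D"
      then obtain q where "j = int m * q"
        using dvd_if_least_positive[OF D_diff D_mult m least] by (auto simp: dvd_def)
      then show "(x, w) [^]\<^bsub>?P\<^esub> j \<in> R"
        using P.subgroup_int_pow_closed[OF sub pm, of q] p by (simp add: P.int_pow_pow)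
    qed
  qed
  have p: "(x, w) \<in> carrier ?P" using x w by simp
  define R' where "R' = R <#>\<^bsub>?P\<^esub> generate ?P {(x, w)}"
  have R'_iff: "u \<in> R' \<longleftrightarrow> (\<exists>r\<in>R. \<exists>j::int. u = r \<otimes>\<^bsub>?P\<^esub> (x, w) [^]\<^bsub>?P\<^esub> j)" for u
    unfolding R'_def set_mult_def P.generate_pow[OF p] by blast
  have "subgroup R' ?P"
    unfolding R'_def using p by (intro P.mult_subgroups sub P.generate_is_subgroup) auto
  \<comment> \<open>The first coordinate of such a product shows that \<open>x [^] j\<close> is the
    inverse of a domain element. So \<open>j \<in> D\<close>, the whole pair falls back into
    \<open>R\<close>, and \<open>sv\<close> applies.\<close>
  moreover have "z = 1" if z: "(\<one>, z) \<in> R'" for z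
  proof -
    obtain r and j :: int where r: "r \<in> R" and eq: "(\<one>, z) = r \<otimes>\<^bsub>?P\<^esub> (x, w) [^]\<^bsub>?P\<^esub> j"
      using z unfolding R'_iff by blast
    have "\<one> = fst r \<otimes> x [^] j"
      using arg_cong[OF eq, of fst] fst_int_pow[OF p, of j] by (simp add: mult_DirProd')
    moreover have "fst r \<in> carrier G" using R.mem_carrier[OF r] by auto
    ultimately have "x [^] j = inv (fst r)"
      using x(1) by (intro inv_equality[symmetric]) (simp_all add: m_comm)
    also have "\<dots> \<in> fst ` R" using r subgroup.m_inv_closed[OF fst_sub] by blast
    finally have "(x, w) [^]\<^bsub>?P\<^esub> j \<in> R" using w_D by (simp add: D_def)
    then have "(\<one>, z) \<in> R" unfolding eq by (rule R.m_closed[OF r])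
    then show ?thesis by (rule sv)
  qed
  ultimately have "char_graph G R'" by (auto simp: char_graph_def)
  moreover have "R \<subseteq> R'"
  proof
    fix r assume "r \<in> R"
    then have "r = r \<otimes>\<^bsub>?P\<^esub> (x, w) [^]\<^bsub>?P\<^esub> (0::int)"
      using P.r_one[OF R.mem_carrier] by simp
    with \<open>r \<in> R\<close> show "r \<in> R'" unfolding R'_iff by blast
  qed
  moreover have "(x, w) = \<one>\<^bsub>?P\<^esub> \<otimes>\<^bsub>?P\<^esub> (x, w) [^]\<^bsub>?P\<^esub> (1::int)"
    using P.l_one[OF p] P.int_pow_1[OF p] by simp
  then have "(x, w) \<in> R'" unfolding R'_iff using R.one_closed by blast
  ultimately show ?thesis using that w(2) by blast
qed

text \<open>The upper bound for Zorn's lemma: two pairs in the union lie in a common member of the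
  chain, and the condition at the identity concerns one pair at a time.\<close>

lemma char_graph_Union_chain:
  assumes "group G" and chain: "subset.chain (Collect (char_graph G)) \<C>" and ne: "\<C> \<noteq> {}"
  shows "char_graph G (\<Union>\<C>)"
proof -
  interpret C: comm_group circle_group by (rule comm_group_circle_group)
  interpret P: group "G \<times>\<times> circle_group"
    using assms(1) by (intro DirProd_group C.is_group)
  let ?P = "G \<times>\<times> circle_group"
  have cg: "char_graph G R" if "R \<in> \<C>" for R
    using chain that by (auto simp: subset.chain_def)
  then have sub: "subgroup R ?P" if "R \<in> \<C>" for R
    using that by (auto simp: char_graph_def)
  have "subgroup (\<Union>\<C>) ?P"
  proof (rule P.subgroupI)
    show "\<Union>\<C> \<subseteq> carrier ?P" using subgroup.subset[OF sub] by blast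
    show "\<Union>\<C> \<noteq> {}" using subgroup.one_closed[OF sub] ne by blast
    show "inv\<^bsub>?P\<^esub> a \<in> \<Union>\<C>" if "a \<in> \<Union>\<C>" for a
      using that subgroup.m_inv_closed[OF sub] by blast
    show "a \<otimes>\<^bsub>?P\<^esub> b \<in> \<Union>\<C>" if ab: "a \<in> \<Union>\<C>" "b \<in> \<Union>\<C>" for a b
    proof -
      obtain R S where RS: "R \<in> \<C>" "S \<in> \<C>" "a \<in> R" "b \<in> S" using ab by blast
      then have "R \<subseteq> S \<or> S \<subseteq> R" using chain by (auto simp: subset.chain_def)
      then obtain T where "T \<in> \<C>" "a \<in> T" "b \<in> T" using RS by blast
      then show ?thesis using subgroup.m_closed[OF sub] by blast
    qed
  qed
  then show ?thesis using cg by (auto simp: char_graph_def)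
qed

text \<open>A maximal graph above \<open>R\<close> has full domain, since
  \<open>char_graph_extend\<close> would enlarge it at any missing point.\<close>

lemma (in comm_group) char_graph_total_extension:
  assumes "char_graph G R"
  obtains M where "char_graph G M" "R \<subseteq> M" "fst ` M = carrier G"
proof -
  let ?E = "{S. char_graph G S \<and> R \<subseteq> S}"
  have "\<exists>M\<in>?E. \<forall>S\<in>?E. M \<subseteq> S \<longrightarrow> S = M"
  proof (rule subset_Zorn_nonempty)
    show "?E \<noteq> {}" using assms by blast
    fix \<C> assume ne: "\<C> \<noteq> {}" and ch: "subset.chain ?E \<C>"
    have "subset.chain (Collect (char_graph G)) \<C>"
      using ch by (auto simp: subset.chain_def)
    moreover have "R \<subseteq> \<Union>\<C>" using ne ch by (fastforce simp: subset.chain_def)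
    ultimately show "\<Union>\<C> \<in> ?E"
      using char_graph_Union_chain[OF is_group _ ne] by blast
  qed
  then obtain M where M: "char_graph G M" "R \<subseteq> M"
    and max: "\<And>S. char_graph G S \<Longrightarrow> M \<subseteq> S \<Longrightarrow> S = M" by auto
  have "x \<in> fst ` M" if "x \<in> carrier G" for x
  proof (rule ccontr)
    assume "x \<notin> fst ` M"
    with M(1) that obtain R' w where "char_graph G R'" "M \<subseteq> R'" "(x, w) \<in> R'"
      by (rule char_graph_extend)
    with max \<open>x \<notin> fst ` M\<close> show False by force
  qed
  moreover have "fst ` M \<subseteq> carrier G"
    using M(1) subgroup.subset by (fastforce simp: char_graph_def)
  ultimately show ?thesis using that M by blast
qed

lemma (in comm_group) char_graph_imp_hom:
  assumes M: "char_graph G M" and total: "fst ` M = carrier G"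
  obtains \<chi> where "\<chi> \<in> hom G circle_group" "\<And>x z. (x, z) \<in> M \<Longrightarrow> \<chi> x = z"
proof -
  interpret C: comm_group circle_group by (rule comm_group_circle_group)
  interpret P: group "G \<times>\<times> circle_group"
    by (intro DirProd_group C.is_group is_group)
  interpret M: subgroup M "G \<times>\<times> circle_group"
    using M by (simp add: char_graph_def)
  have unique: "z = z'" if "(x, z) \<in> M" "(x, z') \<in> M" for x z z'
  proof -
    have c: "x \<in> carrier G" "z \<in> carrier circle_group" "z' \<in> carrier circle_group"
      using M.mem_carrier that by auto
    \<comment> \<open>The quotient of two pairs over \<open>x\<close> lies over the identity, where
      only the value 1 is allowed.\<close>
    have "(x, z) \<otimes>\<^bsub>G \<times>\<times> circle_group\<^esub> inv\<^bsub>G \<times>\<times> circle_group\<^esub> (x, z') \<in> M"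
      using that by (intro M.m_closed M.m_inv_closed)
    then have "(\<one>, z \<otimes>\<^bsub>circle_group\<^esub> inv\<^bsub>circle_group\<^esub> z') \<in> M"
      using c by (simp add: inv_DirProd[OF is_group C.is_group] del: circle_group_simps)
    then have "z \<otimes>\<^bsub>circle_group\<^esub> inv\<^bsub>circle_group\<^esub> z' = \<one>\<^bsub>circle_group\<^esub>"
      using M by (simp add: char_graph_def)
    then show ?thesis
      using c by (metis C.inv_equality C.inv_inv C.inv_closed)
  qed
  define \<chi> where "\<chi> x = (THE z. (x, z) \<in> M)" for x
  have \<chi>: "\<chi> x = z" if "(x, z) \<in> M" for x z
    unfolding \<chi>_def using that unique by blast
  have mem: "(x, \<chi> x) \<in> M" if "x \<in> carrier G" for x
    using that total \<chi> by force
  have "\<chi> \<in> hom G circle_group"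
  proof (rule homI)
    show "\<chi> x \<in> carrier circle_group" if "x \<in> carrier G" for x
      using M.mem_carrier[OF mem[OF that]] by simp
    show "\<chi> (x \<otimes> y) = \<chi> x \<otimes>\<^bsub>circle_group\<^esub> \<chi> y" if "x \<in> carrier G" "y \<in> carrier G" for x y
      using \<chi> M.m_closed[OF mem[OF that(1)] mem[OF that(2)]] by simp
  qed
  with that \<chi> show ?thesis by blast
qed

text \<open>Extend the trivial character of \<open>K\<close> first to \<open>b\<close>, with a value
  other than 1, and only then to all of \<open>G\<close>.\<close>

lemma (in comm_group) character_separating:
  assumes K: "subgroup K G" and b: "b \<in> carrier G" "b \<notin> K"
  obtains \<chi> where "\<chi> \<in> hom G circle_group" "\<And>x. x \<in> K \<Longrightarrow> \<chi> x = 1" "\<chi> b \<noteq> 1"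
proof -
  interpret C: comm_group circle_group by (rule comm_group_circle_group)
  have "subgroup (K \<times> {1}) (G \<times>\<times> circle_group)"
    using DirProd_subgroups[OF is_group K C.is_group C.triv_subgroup] by simp
  then have "char_graph G (K \<times> {1})" by (simp add: char_graph_def)
  moreover have "b \<notin> fst ` (K \<times> {1::complex})" using b by auto
  ultimately obtain R w where R: "char_graph G R" "K \<times> {1} \<subseteq> R" "(b, w) \<in> R" "w \<noteq> 1"
    using b(1) char_graph_extend by blast
  obtain M where M: "char_graph G M" "R \<subseteq> M" "fst ` M = carrier G"
    using char_graph_total_extension[OF R(1)] by blast
  obtain \<chi> where "\<chi> \<in> hom G circle_group" "\<And>x z. (x, z) \<in> M \<Longrightarrow> \<chi> x = z"
    using char_graph_imp_hom[OF M(1,3)] by blast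
  with that M(2) R show ?thesis by blast
qed

subsection \<open>Colourings\<close>

lemma partition_on_fibres: "partition_on A ((\<lambda>v. {x \<in> A. c x = v}) ` c ` A)"
  by (rule partition_onI) (auto simp: disjnt_def)

definition grid_cell :: "real \<Rightarrow> complex \<Rightarrow> int \<times> int"
  where "grid_cell \<delta> z = (\<lfloor>Re z / \<delta>\<rfloor>, \<lfloor>Im z / \<delta>\<rfloor>)"

lemma floor_divide_eq_imp_close:
  assumes "\<delta> > 0" "\<lfloor>s / \<delta>\<rfloor> = \<lfloor>t / \<delta>\<rfloor>"
  shows "\<bar>s - t\<bar> \<le> (\<delta>::real)"
proof -
  have "\<bar>s / \<delta> - t / \<delta>\<bar> \<le> 1" using assms(2) by linarith
  then have "\<bar>(s - t) / \<delta>\<bar> \<le> 1" by (simp add: diff_divide_distrib)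
  then show ?thesis using assms(1) by (simp add: abs_divide)
qed

text \<open>Real and imaginary parts each differ by at most \<open>\<delta>\<close>, and the modulus
  is at most the sum of their absolute values.\<close>

lemma grid_cell_eq_imp_close:
  assumes "\<delta> > 0" "grid_cell \<delta> z = grid_cell \<delta> w"
  shows "cmod (z - w) \<le> 2 * \<delta>"
  using cmod_le[of "z - w"] assms
    floor_divide_eq_imp_close[of \<delta> "Re z" "Re w"] floor_divide_eq_imp_close[of \<delta> "Im z" "Im w"]
  by (simp add: grid_cell_def)

lemma finite_grid_cells:
  assumes "\<delta> > 0"
  shows "finite (grid_cell \<delta> ` {z. cmod z = 1})"
proof (rule finite_subset)
  have "\<lfloor>s / \<delta>\<rfloor> \<in> {\<lfloor>- 1 / \<delta>\<rfloor>..\<lfloor>1 / \<delta>\<rfloor>}" if "\<bar>s\<bar> \<le> 1" for s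
    unfolding atLeastAtMost_iff using that assms
    by (intro conjI floor_mono divide_right_mono) auto
  then show "grid_cell \<delta> ` {z. cmod z = 1} \<subseteq>
      {\<lfloor>- 1 / \<delta>\<rfloor>..\<lfloor>1 / \<delta>\<rfloor>} \<times> {\<lfloor>- 1 / \<delta>\<rfloor>..\<lfloor>1 / \<delta>\<rfloor>}"
    unfolding grid_cell_def
    by (intro image_subsetI SigmaI) (metis abs_Re_le_cmod abs_Im_le_cmod mem_Collect_eq)+
qed simp

section \<open>Coordinate embeddings and characters of powers of \<open>G\<close>\<close>

definition single_entry :: "('a, 'b) monoid_scheme \<Rightarrow> nat \<Rightarrow> nat \<Rightarrow> 'a \<Rightarrow> nat \<Rightarrow> 'a"
  where "single_entry G n i g = (\<lambda>j\<in>{..<n}. if j = i then g else \<one>\<^bsub>G\<^esub>)"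

lemma (in comm_group) hom_power_group_eq_prod:
  assumes F: "F \<in> hom (power_group G n) circle_group" and x: "x \<in> carrier (power_group G n)"
  shows "F x = (\<Prod>i<n. F (single_entry G n i (x i)))"
proof -
  interpret C: comm_group circle_group by (rule comm_group_circle_group)
  have grp: "group (power_group G n)" by simp
  \<comment> \<open>Truncations of \<open>x\<close> lead from the identity at \<open>m = 0\<close>
    to \<open>x\<close> at \<open>m = n\<close>; each step multiplies by one single-entry
    tuple.\<close>
  let ?t = "\<lambda>m. \<lambda>j\<in>{..<n}. if j < m then x j else \<one>"
  have xi: "x i \<in> carrier G" if "i < n" for i using x that by auto
  have "F (?t m) = (\<Prod>i<m. F (single_entry G n i (x i)))" if "m \<le> n" for m
    using that
  proof (induction m)
    case 0
    have "?t 0 = \<one>\<^bsub>power_group G n\<^esub>" by simp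
    then show ?case using hom_one[OF F grp C.is_group] by (simp only: circle_group_simps) simp
  next
    case (Suc m)
    have "?t (Suc m) = ?t m \<otimes>\<^bsub>power_group G n\<^esub> single_entry G n m (x m)"
      using Suc.prems xi by (auto simp: single_entry_def fun_eq_iff less_Suc_eq)
    moreover have "?t m \<in> carrier (power_group G n)"
      "single_entry G n m (x m) \<in> carrier (power_group G n)"
      using Suc.prems xi by (auto simp: single_entry_def)
    ultimately have "F (?t (Suc m)) = F (?t m) * F (single_entry G n m (x m))"
      using hom_mult[OF F] by (simp only: circle_group_simps)
    then show ?case
      using Suc.prems by (simp only: Suc.IH[OF Suc_leD] prod.lessThan_Suc)
  qed
  moreover have "?t n = x" using x by (auto simp: fun_eq_iff PiE_def extensional_def)
  ultimately show ?thesis by (metis order_refl)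
qed

text \<open>The colour records the grid cells of all coordinate characters at once, so replacing
  every \<open>x i\<close> by \<open>y\<close> moves each factor of \<open>F x\<close> only
  slightly.\<close>

lemma (in comm_group) coloring_near_constants:
  assumes F: "F \<in> hom (power_group G n) circle_group" and "\<epsilon> > 0"
  obtains P where "partition_on (carrier G) P" "finite P"
    "\<And>C x y. C \<in> P \<Longrightarrow> x \<in> carrier (power_group G n) \<Longrightarrow> (\<And>i. i < n \<Longrightarrow> x i \<in> C) \<Longrightarrow> y \<in> C \<Longrightarrow>
      cmod (F x - F (\<lambda>i\<in>{..<n}. y)) < \<epsilon>"
proof -
  \<comment> \<open>The \<open>n\<close> factors contribute at most \<open>2 * \<delta>\<close>
    each; the extra 1 makes the final bound strict and covers \<open>n = 0\<close>.\<close>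
  define \<delta> where "\<delta> = \<epsilon> / (2 * n + 1)"
  have \<delta>: "\<delta> > 0" using \<open>\<epsilon> > 0\<close> by (simp add: \<delta>_def)
  define f where "f i g = F (single_entry G n i g)" for i g
  have norm_f: "cmod (f i g) = 1" if "g \<in> carrier G" for i g
  proof -
    have "single_entry G n i g \<in> carrier (power_group G n)"
      using that by (auto simp: single_entry_def)
    then show ?thesis using F by (auto simp: f_def hom_def)
  qed
  define c where "c g = (\<lambda>i\<in>{..<n}. grid_cell \<delta> (f i g))" for g
  define P where "P = (\<lambda>v. {g \<in> carrier G. c g = v}) ` c ` carrier G"
  have "c ` carrier G \<subseteq> (\<Pi>\<^sub>E i\<in>{..<n}. grid_cell \<delta> ` {z. cmod z = 1})"
    unfolding c_def by (intro image_subsetI restrict_PiE) (use norm_f in auto)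
  then have "finite (c ` carrier G)"
    by (rule finite_subset) (intro finite_PiE finite_grid_cells \<delta> finite_lessThan)
  then have "finite P" by (simp add: P_def)
  moreover have "partition_on (carrier G) P"
    unfolding P_def by (rule partition_on_fibres)
  moreover have "cmod (F x - F (\<lambda>i\<in>{..<n}. y)) < \<epsilon>"
    if C: "C \<in> P" and x: "x \<in> carrier (power_group G n)"
      and xC: "\<And>i. i < n \<Longrightarrow> x i \<in> C" and y: "y \<in> C" for C x y
  proof -
    obtain v where v: "C = {g \<in> carrier G. c g = v}" using C by (auto simp: P_def)
    have yG: "y \<in> carrier G" using y v by simp
    have close: "cmod (f i (x i) - f i y) \<le> 2 * \<delta>" if "i < n" for i
    proof (rule grid_cell_eq_imp_close[OF \<delta>])
      have "c (x i) i = c y i" using xC[OF that] y v by simp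
      then show "grid_cell \<delta> (f i (x i)) = grid_cell \<delta> (f i y)"
        using that by (simp add: c_def)
    qed
    have "F x = (\<Prod>i<n. f i (x i))"
      unfolding f_def by (rule hom_power_group_eq_prod[OF F x])
    moreover have "F (\<lambda>i\<in>{..<n}. y) = (\<Prod>i<n. f i y)"
      using hom_power_group_eq_prod[OF F, of "\<lambda>i\<in>{..<n}. y"] yG by (auto simp: f_def)
    \<comment> \<open>For factors of modulus at most 1, a difference of products is bounded by the
      sum of the factorwise differences.\<close>
    ultimately have "cmod (F x - F (\<lambda>i\<in>{..<n}. y)) \<le> (\<Sum>i<n. cmod (f i (x i) - f i y))"
      using norm_prod_diff[of "{..<n}" "\<lambda>i. f i (x i)" "\<lambda>i. f i y"] norm_f yG x
      by (simp add: PiE_iff)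
    also have "\<dots> \<le> (\<Sum>i<n. 2 * \<delta>)" using close by (intro sum_mono) auto
    also have "\<dots> = 2 * n * \<delta>" by simp
    also have "\<dots> < (2 * n + 1) * \<delta>" using \<delta> by (simp add: algebra_simps)
    also have "\<dots> = \<epsilon>" by (simp add: \<delta>_def)
    finally show ?thesis .
  qed
  ultimately show ?thesis using that by blast
qed

section \<open>Constant tuples and the equivalence\<close>

lemma (in comm_group) comm_group_power_group: "comm_group (power_group G k)"
proof (rule group.group_comm_groupI)
  show "group (power_group G k)" by simp
  show "x \<otimes>\<^bsub>power_group G k\<^esub> y = y \<otimes>\<^bsub>power_group G k\<^esub> x"
    if "x \<in> carrier (power_group G k)" "y \<in> carrier (power_group G k)" for x y
    unfolding mult_product_group using that
    by (intro restrict_ext m_comm) (auto simp: PiE_iff)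
qed

lemma (in comm_group) constant_tuple_hom: "(\<lambda>y. \<lambda>i\<in>{..<n}. y) \<in> hom G (power_group G n)"
proof (rule homI)
  show "(\<lambda>i\<in>{..<n}. y) \<in> carrier (power_group G n)" if "y \<in> carrier G" for y
    using that by auto
  show "(\<lambda>i\<in>{..<n}. y \<otimes> z) =
      (\<lambda>i\<in>{..<n}. y) \<otimes>\<^bsub>power_group G n\<^esub> (\<lambda>i\<in>{..<n}. z)" for y z
    unfolding mult_product_group by (rule restrict_ext) simp
qed

theorem theorem4p2:
  fixes G :: "('a, 'b) monoid_scheme" and k n :: nat
    and A :: "(nat \<Rightarrow> 'a) \<Rightarrow> (nat \<Rightarrow> 'a)" and b :: "nat \<Rightarrow> 'a"
  assumes "comm_group G"
    and "A \<in> hom (power_group G n) (power_group G k)"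
    and "b \<in> carrier (power_group G k)"
    and "b \<noteq> \<one>\<^bsub>power_group G k\<^esub>"
  shows "partition_regular G n A b \<longleftrightarrow>
    (\<exists>y \<in> carrier G. A (\<lambda>i\<in>{..<n}. y) = b)"
proof
  interpret comm_group G by fact
  interpret H: comm_group "power_group G k" by (rule comm_group_power_group)
  let ?const = "\<lambda>y. \<lambda>i\<in>{..<n}. y"
  assume pr: "partition_regular G n A b"
  show "\<exists>y \<in> carrier G. A (?const y) = b"
  proof (rule ccontr)
    assume no: "\<not> (\<exists>y \<in> carrier G. A (?const y) = b)"
    define K where "K = (A \<circ> ?const) ` carrier G"
    have "A \<circ> ?const \<in> hom G (power_group G k)"
      by (rule Group.hom_compose[OF constant_tuple_hom assms(2)])
    then have "subgroup K (power_group G k)"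
      unfolding K_def
      by (intro group_hom.img_is_subgroup group_hom.intro group_hom_axioms.intro is_group H.is_group)
    moreover have "b \<notin> K" using no by (auto simp: K_def)
    ultimately obtain \<chi> where \<chi>: "\<chi> \<in> hom (power_group G k) circle_group"
      "\<And>x. x \<in> K \<Longrightarrow> \<chi> x = 1" "\<chi> b \<noteq> 1"
      using H.character_separating assms(3) by metis
    have "\<chi> \<circ> A \<in> hom (power_group G n) circle_group"
      by (rule Group.hom_compose[OF assms(2) \<chi>(1)])
    \<comment> \<open>This distance serves as \<open>\<epsilon>\<close>: a monochromatic solution
      would put \<open>\<chi> b\<close> strictly closer to 1 than it is.\<close>
    moreover have "cmod (\<chi> b - 1) > 0" using \<chi>(3) by simp
    ultimately obtain P where P: "partition_on (carrier G) P" "finite P"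
      and near: "\<And>C x y. C \<in> P \<Longrightarrow> x \<in> carrier (power_group G n) \<Longrightarrow>
        (\<And>i. i < n \<Longrightarrow> x i \<in> C) \<Longrightarrow> y \<in> C \<Longrightarrow>
        cmod ((\<chi> \<circ> A) x - (\<chi> \<circ> A) (?const y)) < cmod (\<chi> b - 1)"
      using coloring_near_constants by blast
    from pr P obtain x C where x: "x \<in> carrier (power_group G n)" "A x = b"
      and C: "C \<in> P" "\<forall>i<n. x i \<in> C"
      unfolding partition_regular_def by blast
    \<comment> \<open>The point \<open>y\<close> is drawn from the class itself rather than from the
      entries of \<open>x\<close>, so \<open>n = 0\<close> needs no separate case.\<close>
    have "C \<noteq> {}" "C \<subseteq> carrier G"
      using C(1) partition_onD1[OF P(1)] partition_onD3[OF P(1)] by blast+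
    then obtain y where y: "y \<in> C" "y \<in> carrier G" by blast
    have "\<chi> (A (?const y)) = 1" using \<chi>(2) y(2) by (auto simp: K_def)
    with near[OF C(1) x(1) _ y(1)] C(2) x(2) show False by simp
  qed
next
  assume "\<exists>y \<in> carrier G. A (\<lambda>i\<in>{..<n}. y) = b"
  then obtain y where y: "y \<in> carrier G" "A (\<lambda>i\<in>{..<n}. y) = b" by blast
  show "partition_regular G n A b"
    unfolding partition_regular_def
  proof (intro allI impI)
    fix P assume "partition_on (carrier G) P \<and> finite P"
    \<comment> \<open>The class of \<open>y\<close> contains every entry of the constant
      solution.\<close>
    then obtain C where "C \<in> P" "y \<in> C" using y(1) by (auto simp: partition_on_def)
    with y show "\<exists>x \<in> carrier (power_group G n). A x = b \<and> (\<exists>C\<in>P. \<forall>i<n. x i \<in> C)"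
      by (intro bexI[of _ "\<lambda>i\<in>{..<n}. y"]) auto
  qed
qed

end
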